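(* Let $r\ge1$, $x\in\mathbb{R}^d$, and let $\omega$ be a continuous and increasing function on $[0,1]$. Let $\mathcal{P}_\omega$ be the set of probability measures $P$ on $\mathbb{R}^d$ such that $\omega(u)\ge\tilde\omega_x(u)$ for any $u\in[0,1]$, where $\tilde\omega_x$ is the modulus of continuity of the quantile function $F_x^{-1}$ of the push-forward of $P$ by $y\mapsto\|y-x\|^r$. Assume that there exist $P\in\mathcal{P}_\omega$, $c>0$ and $\bar u\in(0,1)$ such that $$c\left[F_x^{-1}(u)-F_x^{-1}(0)\right]\ge\omega(u)\quad\text{for any }u\in(0,\bar u].$$ Then there exists a constant $C>0$ which only depends on $c$ such that, for any integers $n\ge 1$ and $1\le k\le\bar u n$, $$\sup_{P\in\mathcal{P}_\omega}\mathbb{E}\left(|\Delta_{n,\frac kn,r}(x)|\right)\ \ge\ \inf_{\hat d_n(x)}\ \sup_{P\in\mathcal{P}_\omega}\mathbb{E}\left(\left|\hat d_n^{\,r}(x)-d^r_{P,\frac kn,r}(x)\right|\right)\ \ge\ C\,\frac nk\,\frac1n\,\omega\left(\frac{k-1}{n}\right),$$ where the infimum is taken over all estimators $\hat d_n(x)$ of $d_{P,\frac kn,r}(x)$ defined from an i.i.d. sample $X_1,\dots,X_n$ of distribution $P$.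
   Context: $\|\cdot\|$ is the Euclidean norm. For a distribution function $F$ on $\mathbb{R}$, the quantile function is $F^{-1}(u)=\inf\{t: F(t)\ge u\}$ for $0<u<1$, with $F^{-1}(0)=\inf\{t:F(t)>0\}$ and $F^{-1}(1)=\sup\{t:F(t)<1\}$. $F_x$ denotes the distribution function of $\|x-X\|^r$ with $X\sim P$. The modulus of continuity of $F_x^{-1}$ is $\tilde\omega_x(v)=\sup\{|F_x^{-1}(u)-F_x^{-1}(u')|:u,u'\in[0,1],|u-u'|\le v\}$ for $v\in(0,1]$, and $\tilde\omega_x(0)=\lim_{v\to0^+}\tilde\omega_x(v)$. The distance to the measure $P$ with parameters $m\in(0,1]$ and $r\geq 1$ is given by $d^r_{P,m,r}(x)=\frac1m\int_0^m\delta_{P,u}^r(x)\,du$, where $\delta_{P,u}(x)=\inf\{t>0:P(\bar B(x,t))\ge u\}$ and $\bar B(x,t)$ is the closed Euclidean ball; equivalently $d^r_{P,m,r}(x)=\frac1m\int_0^mF_x^{-1}(u)\,du$. Finally $\Delta_{n,m,r}(x)=d^r_{P_n,m,r}(x)-d^r_{P,m,r}(x)$, where $P_n$ is the empirical measure of $X_1,\dots,X_n$. *)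

theory Defs
  imports "HOL-Probability.Probability"
begin

text \<open>
  The dimension \<open>d\<close> has to be quantified inside the theorem (the constant must not depend on it),
  so points of $R^d$ are the functions in \<open>{..<d} \<rightarrow>\<^sub>E UNIV\<close>, with the product Borel
  sigma-algebra.
\<close>

definition euclid :: "nat \<Rightarrow> (nat \<Rightarrow> real) measure" where
  "euclid d = (\<Pi>\<^sub>M i\<in>{..<d}. borel)"

definition edist :: "nat \<Rightarrow> (nat \<Rightarrow> real) \<Rightarrow> (nat \<Rightarrow> real) \<Rightarrow> real" where
  "edist d x y = L2_set (\<lambda>i. x i - y i) {..<d}"

definition eball :: "nat \<Rightarrow> (nat \<Rightarrow> real) \<Rightarrow> real \<Rightarrow> (nat \<Rightarrow> real) set" where
  "eball d x t = {y \<in> space (euclid d). edist d x y \<le> t}"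

definition dist_cdf :: "nat \<Rightarrow> real \<Rightarrow> (nat \<Rightarrow> real) \<Rightarrow> (nat \<Rightarrow> real) measure \<Rightarrow> real \<Rightarrow> real" where
  "dist_cdf d r x P = cdf (distr P borel (\<lambda>y. edist d x y powr r))"

text \<open>
  Extended-real valued, since the value at 1 is \<open>\<infinity>\<close> for a law of unbounded support.
  Only arguments in \<open>{0..1}\<close> are meaningful.
\<close>

definition quantile :: "(real \<Rightarrow> real) \<Rightarrow> real \<Rightarrow> ereal" where
  "quantile F u =
     (if u = 0 then Inf (ereal ` {t. F t > 0})
      else if u = 1 then Sup (ereal ` {t. F t < 1})
      else Inf (ereal ` {t. F t \<ge> u}))"

definition quantile_osc :: "(real \<Rightarrow> real) \<Rightarrow> real \<Rightarrow> ereal" where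
  "quantile_osc F v =
     Sup {\<bar>quantile F u - quantile F u'\<bar> | u u'. u \<in> {0..1} \<and> u' \<in> {0..1} \<and> \<bar>u - u'\<bar> \<le> v}"

definition quantile_modulus :: "(real \<Rightarrow> real) \<Rightarrow> real \<Rightarrow> ereal" where
  "quantile_modulus F v =
     (if v = 0 then Lim (at_right 0) (quantile_osc F) else quantile_osc F v)"

definition modulus_class ::
  "nat \<Rightarrow> real \<Rightarrow> (nat \<Rightarrow> real) \<Rightarrow> (real \<Rightarrow> real) \<Rightarrow> (nat \<Rightarrow> real) measure set" where
  "modulus_class d r x \<omega> =
     {P. prob_space P \<and> sets P = sets (euclid d) \<and>
         (\<forall>u\<in>{0..1}. quantile_modulus (dist_cdf d r x P) u \<le> ereal (\<omega> u))}"

definition delta :: "nat \<Rightarrow> (nat \<Rightarrow> real) measure \<Rightarrow> real \<Rightarrow> (nat \<Rightarrow> real) \<Rightarrow> real" where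
  "delta d P u x = Inf {t. t > 0 \<and> measure P (eball d x t) \<ge> u}"

text \<open>
  The \<open>r\<close>-th power of the distance to the measure.  For a probability measure and
  \<open>0 < m < 1\<close> the integrand is bounded and monotone on \<open>{0..m}\<close>, so the real-valued integral
  is the intended one; at \<open>m = 1\<close> it is so only when the integral is finite.
\<close>

definition dtm_pow ::
  "nat \<Rightarrow> (nat \<Rightarrow> real) measure \<Rightarrow> real \<Rightarrow> real \<Rightarrow> (nat \<Rightarrow> real) \<Rightarrow> real" where
  "dtm_pow d P m r x = (1 / m) * (LBINT u:{0..m}. delta d P u x powr r)"

definition sample_law ::
  "nat \<Rightarrow> (nat \<Rightarrow> real) measure \<Rightarrow> (nat \<Rightarrow> nat \<Rightarrow> real) measure" where
  "sample_law n P = (\<Pi>\<^sub>M i\<in>{1..n}. P)"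

definition empirical :: "nat \<Rightarrow> nat \<Rightarrow> (nat \<Rightarrow> nat \<Rightarrow> real) \<Rightarrow> (nat \<Rightarrow> real) measure" where
  "empirical d n X = distr (uniform_count_measure {1..n}) (euclid d) X"

definition Delta ::
  "nat \<Rightarrow> (nat \<Rightarrow> real) measure \<Rightarrow> nat \<Rightarrow> real \<Rightarrow> real \<Rightarrow> (nat \<Rightarrow> real) \<Rightarrow>
   (nat \<Rightarrow> nat \<Rightarrow> real) \<Rightarrow> real" where
  "Delta d P n m r x X = dtm_pow d (empirical d n X) m r x - dtm_pow d P m r x"

text \<open>
  Estimators of the (nonnegative) distance itself are nonnegative measurable functions of the
  sample, so that their \<open>r\<close>-th power makes sense for real \<open>r\<close>.
\<close>

definition estimators :: "nat \<Rightarrow> nat \<Rightarrow> ((nat \<Rightarrow> nat \<Rightarrow> real) \<Rightarrow> real) set" where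
  "estimators d n =
     {T. T \<in> borel_measurable (\<Pi>\<^sub>M i\<in>{1..n}. euclid d) \<and>
         (\<forall>X\<in>space (\<Pi>\<^sub>M i\<in>{1..n}. euclid d). 0 \<le> T X)}"

end

theory Submission
  imports Defs
begin

text \<open>
  Lower bound: let \<open>q\<close> be the quantile function of the given \<open>P\<close>, which is continuous because
  \<open>\<omega> 0 = 0\<close>.  For \<open>U\<close> uniform on \<open>{0..1}\<close>, place a point at distance \<open>q U powr (1 / r)\<close> from \<open>x\<close>
  along the first axis, and compare with the law that sends the top mass \<open>a\<close> (the event
  \<open>U > 1 - a\<close>) to the bottom value \<open>q 0\<close>.  The second law has quantile function \<open>q (u - a)\<close>, with
  \<open>q\<close> extended by constants, so both satisfy the modulus bound.  Their distances to
  measure differ by at least \<open>a / m * (q (m - a) - q 0)\<close>, where \<open>m = k / n\<close>, while \<open>n\<close>-samples can be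
  coupled to coincide with probability \<open>(1 - a) ^ n\<close>.

  Upper inequality: the plug-in distance to the empirical measure is itself an estimator;
  only its measurability needs an argument.
\<close>

section \<open>Measurability of the plug-in estimator and the upper inequality\<close>

lemma borel_measurable_edist [measurable]: "edist d x \<in> borel_measurable (euclid d)"
  unfolding edist_def L2_set_def euclid_def by measurable

lemma sets_eball [measurable]: "eball d x t \<in> sets (euclid d)"
  unfolding eball_def by measurable

lemma measure_empirical:
  assumes X: "X \<in> space (\<Pi>\<^sub>M i\<in>{1..n}. euclid d)" and B: "B \<in> sets (euclid d)" and "1 \<le> n"
  shows "measure (empirical d n X) B = (\<Sum>i\<in>{1..n}. indicator B (X i)) / real n"
proof -
  have *: "X \<in> measurable (uniform_count_measure {1..n}) (euclid d)"
    using X by (auto simp: measurable_def sets_uniform_count_measure space_PiM space_uniform_count_measure)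
  have "measure (empirical d n X) B = measure (uniform_count_measure {1..n}) (X -` B \<inter> {1..n})"
    unfolding empirical_def by (subst measure_distr[OF * B]) (simp add: space_uniform_count_measure)
  also have "\<dots> = card (X -` B \<inter> {1..n}) / real n"
    by (subst measure_uniform_count_measure) auto
  also have "real (card (X -` B \<inter> {1..n})) = (\<Sum>i\<in>{1..n}. indicator (X -` B) i)"
    by (simp add: indicator_def Int_def vimage_def conj_commute)
  finally show ?thesis
    by (simp add: indicator_vimage[unfolded o_def] indicator_def)
qed

lemma measure_empirical_eball_mono:
  assumes X: "X \<in> space (\<Pi>\<^sub>M i\<in>{1..n}. euclid d)" and "1 \<le> n" "s \<le> t"
  shows "measure (empirical d n X) (eball d x s) \<le> measure (empirical d n X) (eball d x t)"
  using \<open>s \<le> t\<close> by (subst (1 2) measure_empirical[OF X _ \<open>1 \<le> n\<close>])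
    (auto intro!: divide_right_mono card_mono simp: indicator_def eball_def)

text \<open>The mass of a ball grows with its radius, so a real radius below \<open>t\<close> can be
  enlarged to a rational one. The infimum thus becomes a countable condition on the sample. For
  \<open>u <= 1\<close> the set of radii is nonempty, since the ball of radius \<open>R\<close>
  contains the whole sample.\<close>

lemma delta_empirical_less_iff:
  assumes X: "X \<in> space (\<Pi>\<^sub>M i\<in>{1..n}. euclid d)" and "1 \<le> n" "u \<le> 1"
  shows "delta d (empirical d n X) u x < t \<longleftrightarrow>
    (\<exists>s\<in>\<rat>. 0 < s \<and> s < t \<and> u \<le> measure (empirical d n X) (eball d x s))"
proof -
  let ?S = "{t. t > 0 \<and> measure (empirical d n X) (eball d x t) \<ge> u}"
  define R where "R = 1 + (\<Sum>i\<in>{1..n}. edist d x (X i))"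
  have nonneg: "0 \<le> edist d x y" for y
    by (simp add: edist_def L2_set_nonneg)
  have "edist d x (X i) \<le> R" if "i \<in> {1..n}" for i
    unfolding R_def using member_le_sum[OF that, of "\<lambda>i. edist d x (X i)"] nonneg by simp
  moreover have "X i \<in> space (euclid d)" if "i \<in> {1..n}" for i
    using X that by (auto simp: space_PiM)
  ultimately have "measure (empirical d n X) (eball d x R) = 1"
    using \<open>1 \<le> n\<close> by (subst measure_empirical[OF X _ \<open>1 \<le> n\<close>]) (auto simp: eball_def)
  moreover have "R > 0"
    unfolding R_def using sum_nonneg[of "{1..n}" "\<lambda>i. edist d x (X i)"] nonneg by force
  ultimately have ne: "?S \<noteq> {}"
    using \<open>u \<le> 1\<close> by auto
  have bdd: "bdd_below ?S"
    by (intro bdd_belowI[of _ 0]) auto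
  have "delta d (empirical d n X) u x < t \<longleftrightarrow> (\<exists>s\<in>?S. s < t)"
    unfolding delta_def by (rule cInf_less_iff[OF ne bdd])
  also have "\<dots> \<longleftrightarrow> (\<exists>s\<in>\<rat>. 0 < s \<and> s < t \<and> u \<le> measure (empirical d n X) (eball d x s))"
  proof
    assume "\<exists>s\<in>?S. s < t"
    then obtain s where s: "s \<in> ?S" "s < t" by blast
    obtain s' where "s' \<in> \<rat>" "s < s'" "s' < t"
      using Rats_dense_in_real[OF \<open>s < t\<close>] by blast
    moreover have "u \<le> measure (empirical d n X) (eball d x s')"
      using s measure_empirical_eball_mono[OF X \<open>1 \<le> n\<close>, of s s' x] \<open>s < s'\<close> by simp
    ultimately show "\<exists>s\<in>\<rat>. 0 < s \<and> s < t \<and> u \<le> measure (empirical d n X) (eball d x s)"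
      using s by (intro bexI[of _ s']) auto
  qed auto
  finally show ?thesis .
qed

text \<open>The integrand is shown to be jointly measurable in the sample and the level
  \<open>u\<close>; measurability of the parameter integral in the sample then follows.\<close>

lemma borel_measurable_dtm_pow_empirical:
  assumes "1 \<le> n" "m \<le> 1"
  shows "(\<lambda>X. dtm_pow d (empirical d n X) m r x) \<in> borel_measurable (\<Pi>\<^sub>M i\<in>{1..n}. euclid d)"
proof -
  let ?M = "\<Pi>\<^sub>M i\<in>{1..n}. euclid d"
  let ?N = "?M \<Otimes>\<^sub>M lborel"
  have count [measurable]: "(\<lambda>X. measure (empirical d n X) (eball d x s)) \<in> borel_measurable ?M" for s
  proof -
    have "(\<lambda>X. (\<Sum>i\<in>{1..n}. indicator (eball d x s) (X i)) / real n) \<in> borel_measurable ?M"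
      by measurable
    then show ?thesis
      by (subst measurable_cong[OF measure_empirical[OF _ sets_eball \<open>1 \<le> n\<close>]])
  qed
  \<comment> \<open>The cut-off to 0 outside \<open>{0..m}\<close> keeps all levels in play at most
    1, where the rational characterisation is available; the integral over \<open>{0..m}\<close>
    does not see it.\<close>
  have "(\<lambda>(X, u). if u \<in> {0..m} then delta d (empirical d n X) u x else 0) \<in> borel_measurable ?N"
  proof (subst borel_measurable_iff_less, rule allI)
    fix t :: real
    have "{w \<in> space ?N. (case w of (X, u) \<Rightarrow> if u \<in> {0..m} then delta d (empirical d n X) u x else 0) < t}
      = {w \<in> space ?N. if snd w \<in> {0..m} then \<exists>s\<in>\<rat>. 0 < s \<and> s < t \<and>
          snd w \<le> measure (empirical d n (fst w)) (eball d x s) else 0 < t}"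
      using \<open>m \<le> 1\<close> by (intro Collect_cong) (auto simp: space_pair_measure delta_empirical_less_iff[OF _ \<open>1 \<le> n\<close>])
    also have "\<dots> \<in> sets ?N"
      using countable_rat by measurable
    finally show "{w \<in> space ?N. (case w of (X, u) \<Rightarrow> if u \<in> {0..m} then delta d (empirical d n X) u x else 0) < t} \<in> sets ?N" .
  qed
  then have [measurable]: "(\<lambda>w. if snd w \<in> {0..m} then delta d (empirical d n (fst w)) (snd w) x else 0) \<in> borel_measurable ?N"
    by (simp add: case_prod_beta')
  have "(\<lambda>(X, u). indicator {0..m} u *\<^sub>R
     ((if u \<in> {0..m} then delta d (empirical d n X) u x else 0) powr r)) \<in> borel_measurable ?N"
    unfolding case_prod_beta' by measurable
  from lborel.borel_measurable_lebesgue_integral[OF this]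
  have "(\<lambda>X. LBINT u:{0..m}. (if u \<in> {0..m} then delta d (empirical d n X) u x else 0) powr r) \<in> borel_measurable ?M"
    unfolding set_lebesgue_integral_def by (simp only: prod.case)
  also have "(\<lambda>X. LBINT u:{0..m}. (if u \<in> {0..m} then delta d (empirical d n X) u x else 0) powr r) =
     (\<lambda>X. LBINT u:{0..m}. delta d (empirical d n X) u x powr r)"
    by (intro ext set_lebesgue_integral_cong) auto
  finally show ?thesis
    unfolding dtm_pow_def by measurable
qed

lemma dtm_pow_nonneg: "0 \<le> m \<Longrightarrow> 0 \<le> dtm_pow d P m r x"
  unfolding dtm_pow_def set_lebesgue_integral_def
  by (intro mult_nonneg_nonneg Bochner_Integration.integral_nonneg) auto

lemma minimax_le_empirical_risk:
  assumes "1 \<le> n" "1 \<le> r" "0 \<le> m" "m \<le> 1"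
  shows "(INF T\<in>estimators d n. SUP P\<in>modulus_class d r x \<omega>.
          \<integral>\<^sup>+ X. ennreal \<bar>T X powr r - dtm_pow d P m r x\<bar> \<partial>sample_law n P)
    \<le> (SUP P\<in>modulus_class d r x \<omega>. \<integral>\<^sup>+ X. ennreal \<bar>Delta d P n m r x X\<bar> \<partial>sample_law n P)"
proof -
  \<comment> \<open>Estimators target the distance itself, hence the root. Raising it to the power
    \<open>r\<close> gives back the plug-in value because that value is nonnegative.\<close>
  define T where "T = (\<lambda>X. dtm_pow d (empirical d n X) m r x powr (1 / r))"
  have "T \<in> estimators d n"
    unfolding estimators_def T_def
    using borel_measurable_dtm_pow_empirical[OF \<open>1 \<le> n\<close> \<open>m \<le> 1\<close>] by auto
  moreover have "T X powr r = dtm_pow d (empirical d n X) m r x" for X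
    using \<open>1 \<le> r\<close> dtm_pow_nonneg[OF \<open>0 \<le> m\<close>] by (simp add: T_def powr_powr)
  ultimately show ?thesis
    unfolding Delta_def by (intro INF_lower2[of T]) auto
qed

section \<open>Quantile functions of images of the uniform law\<close>

definition unif :: "real measure" where
  "unif = uniform_measure lborel {0..1}"

lemma sets_unif [measurable_cong, simp]: "sets unif = sets borel"
  by (simp add: unif_def)

lemma space_unif [simp]: "space unif = UNIV"
  by (simp add: unif_def)

lemma prob_space_unif: "prob_space unif"
  unfolding unif_def by (intro prob_space_uniform_measure) auto

lemma measure_unif: "B \<in> sets borel \<Longrightarrow> measure unif B = measure lborel ({0..1} \<inter> B)"
  unfolding unif_def by (subst measure_uniform_measure) auto

lemma measure_unif_atMost: "0 \<le> u \<Longrightarrow> u \<le> 1 \<Longrightarrow> measure unif {..u} = u"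
proof -
  assume "0 \<le> u" "u \<le> 1"
  then have "{0..1} \<inter> {..u} = {0..u}" by auto
  with \<open>0 \<le> u\<close> show ?thesis by (simp add: measure_unif)
qed

text \<open>Monotonicity puts \<open>{..u}\<close> inside the level set when
  \<open>q u <= t\<close>. Otherwise continuity gives some \<open>w < u\<close> with
  \<open>q w > t\<close>, and the level set lies in \<open>{..w}\<close>, of mass less than
  \<open>u\<close>. The level 0 is excluded: there the left side always holds.\<close>

lemma le_measure_unif_iff:
  fixes q :: "real \<Rightarrow> real"
  assumes q: "continuous_on UNIV q" "mono q" and u: "0 < u" "u \<le> 1"
  shows "u \<le> measure unif {v. q v \<le> t} \<longleftrightarrow> q u \<le> t"
proof
  interpret prob_space unif by (rule prob_space_unif)
  have [measurable]: "q \<in> borel_measurable borel"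
    using q(1) by (rule borel_measurable_continuous_onI)
  have sets: "{v. q v \<le> t} \<in> sets unif"
    unfolding sets_unif by measurable
  {
    assume "q u \<le> t"
    then have "{..u} \<subseteq> {v. q v \<le> t}"
      using order_trans[OF monoD[OF q(2)]] by auto
    then have "measure unif {..u} \<le> measure unif {v. q v \<le> t}"
      using sets by (rule finite_measure_mono)
    then show "u \<le> measure unif {v. q v \<le> t}"
      using u by (simp add: measure_unif_atMost)
  }
  assume le: "u \<le> measure unif {v. q v \<le> t}"
  show "q u \<le> t"
  proof (rule ccontr)
    assume "\<not> q u \<le> t"
    then have "0 < q u - t" by simp
    then obtain e where e: "e > 0" "\<And>v. dist v u < e \<Longrightarrow> dist (q v) (q u) < q u - t"
      using q(1)[unfolded continuous_on_iff, rule_format, of u "q u - t"] by auto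
    \<comment> \<open>The bound \<open>u / 2\<close> keeps \<open>w\<close> positive, so that
      \<open>{..w}\<close> has mass \<open>w\<close>; the bound \<open>u - e / 2\<close> keeps it
      within the continuity radius.\<close>
    define w where "w = max (u / 2) (u - e / 2)"
    have w: "w > 0" "w < u" "dist w u < e"
      using u e(1) by (auto simp: w_def dist_real_def min_def max_def)
    then have "q w > t"
      using e(2)[of w] by (auto simp: dist_real_def)
    have "v \<le> w" if "q v \<le> t" for v
    proof (rule ccontr)
      assume "\<not> v \<le> w"
      then have "q w \<le> q v" using monoD[OF q(2)] by simp
      with that \<open>q w > t\<close> show False by simp
    qed
    then have "measure unif {v. q v \<le> t} \<le> measure unif {..w}"
      by (intro finite_measure_mono) auto
    then show False
      using w u le by (simp add: measure_unif_atMost)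
  qed
qed

text \<open>By the preceding equivalence, the set defining the quantile is the half-line from
  \<open>q u\<close> upwards for interior \<open>u\<close>, and the open half-line below
  \<open>q 1\<close> for \<open>u = 1\<close>. At \<open>u = 0\<close> the equivalence is applied at
  small positive levels and combined with continuity of \<open>q\<close> at 0.\<close>

lemma quantile_level:
  fixes q :: "real \<Rightarrow> real"
  assumes q: "continuous_on UNIV q" "mono q" and u: "u \<in> {0..1}"
  shows "quantile (\<lambda>t. measure unif {v. q v \<le> t}) u = ereal (q u)"
proof -
  let ?G = "\<lambda>t. measure unif {v. q v \<le> t}"
  consider "u = 0" | "u = 1" | "0 < u" "u < 1"
    using u by fastforce
  then show ?thesis
  proof cases
    case 1
    have "q 0 \<le> t" if "?G t > 0" for t
    proof -
      have "?G t \<le> 1"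
        by (rule prob_space.prob_le_1[OF prob_space_unif])
      \<comment> \<open>The equivalence is used at the level \<open>?G t\<close> itself, where its
        left side is trivially true.\<close>
      then have "q (?G t) \<le> t"
        using le_measure_unif_iff[OF q that, of t] by blast
      then show ?thesis
        using that monoD[OF q(2), of 0 "?G t"] by simp
    qed
    moreover have "?G t > 0" if "q 0 < t" for t
    proof -
      from that have "0 < t - q 0" by simp
      then obtain e where e: "e > 0" "\<And>v. dist v 0 < e \<Longrightarrow> dist (q v) (q 0) < t - q 0"
        using q(1) unfolding continuous_on_iff by blast
      define w where "w = min 1 (e / 2)"
      have w: "0 < w" "w \<le> 1" "dist w 0 < e"
        using e(1) by (auto simp: w_def dist_real_def min_def max_def)
      have "q w \<le> t"
        using e(2)[OF w(3)] by (simp add: dist_real_def)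
      then show ?thesis
        using w(1) le_measure_unif_iff[OF q w(1,2), of t] by linarith
    qed
    ultimately have "Inf (ereal ` {t. ?G t > 0}) = ereal (q 0)"
    proof (intro antisym)
      show "Inf (ereal ` {t. ?G t > 0}) \<le> ereal (q 0)"
      proof (rule ereal_le_epsilon2)
        fix e :: real assume "0 < e"
        then have "?G (q 0 + e) > 0" using \<open>\<And>t. q 0 < t \<Longrightarrow> ?G t > 0\<close>[of "q 0 + e"] by simp
        then show "Inf (ereal ` {t. ?G t > 0}) \<le> ereal (q 0) + ereal e"
          by (intro INF_lower2[of "q 0 + e"]) auto
      qed
    qed (auto intro!: INF_greatest)
    then show ?thesis
      using 1 by (simp add: quantile_def)
  next
    case 2
    have "?G t < 1 \<longleftrightarrow> t < q 1" for t
      using le_measure_unif_iff[OF q, of 1 t] by auto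
    moreover have "Sup (ereal ` {t. t < q 1}) = ereal (q 1)"
    proof (rule antisym)
      show "ereal (q 1) \<le> Sup (ereal ` {t. t < q 1})"
        unfolding le_Sup_iff
        by (metis (mono_tags, lifting) ereal_dense2 imageI less_ereal.simps(1) mem_Collect_eq)
    qed (auto intro!: SUP_least)
    ultimately show ?thesis
      using 2 by (simp add: quantile_def)
  next
    case 3
    have "Inf (ereal ` {t. q u \<le> t}) = ereal (q u)"
      by (intro antisym INF_lower INF_greatest) auto
    then show ?thesis
      using 3 le_measure_unif_iff[OF q, of u] by (simp add: quantile_def)
  qed
qed

lemma quantile_osc_nonneg:
  assumes "0 \<le> v"
  shows "0 \<le> quantile_osc F v"
  unfolding quantile_osc_def
proof (rule Sup_upper2)
  show "\<bar>quantile F 0 - quantile F 0\<bar> \<in> {\<bar>quantile F u - quantile F u'\<bar> | u u'.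
    u \<in> {0..1} \<and> u' \<in> {0..1} \<and> \<bar>u - u'\<bar> \<le> v}"
    using assms by fastforce
qed simp

section \<open>Laws supported on a ray from the centre\<close>

text \<open>The parameter \<open>s\<close> stands for the \<open>r\<close>-th power of the distance
  to \<open>x\<close>. Restricting to \<open>{..<d}\<close> places the point in the extensional
  function space underlying \<open>euclid d\<close>.\<close>

definition ray_point :: "nat \<Rightarrow> real \<Rightarrow> (nat \<Rightarrow> real) \<Rightarrow> real \<Rightarrow> nat \<Rightarrow> real" where
  "ray_point d r x s = (\<lambda>i\<in>{..<d}. if i = 0 then x i + s powr (1 / r) else x i)"

lemma measurable_ray_point [measurable]: "ray_point d r x \<in> measurable borel (euclid d)"
  unfolding ray_point_def euclid_def by measurable

lemma edist_ray_point:
  assumes "1 \<le> d" shows "edist d x (ray_point d r x s) = s powr (1 / r)"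
proof -
  have "(\<Sum>i<d. (x i - ray_point d r x s i)\<^sup>2) = (\<Sum>i<d. if i = 0 then (s powr (1 / r))\<^sup>2 else 0)"
    by (intro sum.cong) (auto simp: ray_point_def)
  then show ?thesis
    using assms by (simp add: edist_def L2_set_def)
qed

text \<open>Here \<open>f\<close> may be any random variable on the uniform space, not only a
  quantile function. Two such laws therefore live on one probability space and can be
  coupled.\<close>

definition ray_law :: "nat \<Rightarrow> real \<Rightarrow> (nat \<Rightarrow> real) \<Rightarrow> (real \<Rightarrow> real) \<Rightarrow> (nat \<Rightarrow> real) measure" where
  "ray_law d r x f = distr unif (euclid d) (\<lambda>u. ray_point d r x (f u))"

lemma prob_space_ray_law:
  assumes [measurable]: "f \<in> borel_measurable borel"
  shows "prob_space (ray_law d r x f)"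
  unfolding ray_law_def by (intro prob_space.prob_space_distr prob_space_unif) measurable

lemma dist_cdf_ray_law:
  assumes "1 \<le> d" "1 \<le> r" and [measurable]: "f \<in> borel_measurable borel" and f: "\<And>u. 0 \<le> f u"
  shows "dist_cdf d r x (ray_law d r x f) = (\<lambda>t. measure unif {v. f v \<le> t})"
proof -
  have "distr (ray_law d r x f) borel (\<lambda>y. edist d x y powr r) = distr unif borel f"
    unfolding ray_law_def using assms
    by (subst distr_distr) (auto intro!: distr_cong simp: edist_ray_point powr_powr)
  then have "dist_cdf d r x (ray_law d r x f) t = measure (distr unif borel f) {..t}" for t
    by (simp add: dist_cdf_def cdf_def)
  moreover have "measure (distr unif borel f) {..t} = measure unif {v. f v \<le> t}" for t
    by (subst measure_distr) (simp_all add: vimage_def)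
  ultimately show ?thesis
    by auto
qed

lemma measure_ray_law_eball:
  assumes "1 \<le> d" "1 \<le> r" and [measurable]: "f \<in> borel_measurable borel" and f: "\<And>u. 0 \<le> f u" and "0 < t"
  shows "measure (ray_law d r x f) (eball d x t) = measure unif {v. f v \<le> t powr r}"
proof -
  have *: "s powr (1 / r) \<le> t \<longleftrightarrow> s \<le> t powr r" if "0 \<le> s" for s
  proof -
    have "s powr (1 / r) \<le> t \<longleftrightarrow> (s powr (1 / r)) powr r \<le> t powr r"
      using assms powr_mono2[of r "s powr (1 / r)" t] powr_less_mono2[of r t "s powr (1 / r)"]
      by (meson leD leI less_imp_le less_le_trans powr_ge_zero zero_less_one)
    then show ?thesis
      using assms that by (simp add: powr_powr)
  qed
  have "ray_point d r x s \<in> space (euclid d)" for s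
    using measurable_space[OF measurable_ray_point[of d r x], of s] by simp
  then have "(\<lambda>u. ray_point d r x (f u)) -` eball d x t \<inter> space unif = {v. f v \<le> t powr r}"
    using * f \<open>1 \<le> d\<close> by (auto simp: eball_def edist_ray_point)
  moreover have "measure (ray_law d r x f) (eball d x t)
      = measure unif ((\<lambda>u. ray_point d r x (f u)) -` eball d x t \<inter> space unif)"
    unfolding ray_law_def by (rule measure_distr) measurable
  ultimately show ?thesis by simp
qed

text \<open>\<open>q\<close> is the quantile function of the law of \<open>f\<close> under the uniform distribution.\<close>

locale uniform_representation =
  fixes f q :: "real \<Rightarrow> real"
  assumes measurable_f [measurable]: "f \<in> borel_measurable borel"
    and f_nonneg: "0 \<le> f u"
    and continuous_q: "continuous_on UNIV q"
    and mono_q: "mono q"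
    and q_nonneg: "0 \<le> q u"
    and same_law: "measure unif {v. f v \<le> t} = measure unif {v. q v \<le> t}"
begin

lemma quantile_ray_law:
  assumes "1 \<le> d" "1 \<le> r" "u \<in> {0..1}"
  shows "quantile (dist_cdf d r x (ray_law d r x f)) u = ereal (q u)"
  using quantile_level[OF continuous_q mono_q assms(3)] dist_cdf_ray_law[OF assms(1,2) measurable_f f_nonneg]
  by (simp add: same_law)

lemma delta_ray_law:
  assumes "1 \<le> d" "1 \<le> r" "0 < u" "u \<le> 1"
  shows "delta d (ray_law d r x f) u x = q u powr (1 / r)"
proof -
  have "u \<le> measure (ray_law d r x f) (eball d x t) \<longleftrightarrow> q u powr (1 / r) \<le> t" if "0 < t" for t
  proof -
    have "u \<le> measure (ray_law d r x f) (eball d x t) \<longleftrightarrow> q u \<le> t powr r"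
      using measure_ray_law_eball[OF assms(1,2) measurable_f f_nonneg that]
        le_measure_unif_iff[OF continuous_q mono_q assms(3,4), of "t powr r"]
      by (simp add: same_law)
    also have "\<dots> \<longleftrightarrow> q u powr (1 / r) \<le> (t powr r) powr (1 / r)"
      using assms q_nonneg
        powr_mono2[of "1 / r" "q u" "t powr r"] powr_less_mono2[of "1 / r" "t powr r" "q u"]
      by (meson leD leI less_imp_le less_le_trans powr_ge_zero zero_less_divide_1_iff zero_less_one)
    finally show ?thesis
      using that assms by (simp add: powr_powr)
  qed
  then have "delta d (ray_law d r x f) u x = Inf {t. 0 < t \<and> q u powr (1 / r) \<le> t}"
    unfolding delta_def by (intro arg_cong[where f = Inf]) auto
  also have "\<dots> = q u powr (1 / r)"
  \<comment> \<open>The definition of \<open>delta\<close> admits positive radii only, so for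
    \<open>q u = 0\<close> the infimum 0 is not attained.\<close>
  proof (cases "q u = 0")
    case True
    then have "{t. 0 < t \<and> q u powr (1 / r) \<le> t} = {0<..}" by auto
    then show ?thesis using True by simp
  next
    case False
    then have "{t. 0 < t \<and> q u powr (1 / r) \<le> t} = {q u powr (1 / r)..}"
      by (auto intro: less_le_trans[rotated])
    then show ?thesis by simp
  qed
  finally show ?thesis .
qed

lemma dtm_pow_ray_law:
  assumes "1 \<le> d" "1 \<le> r" "0 < m" "m \<le> 1"
  shows "dtm_pow d (ray_law d r x f) m r x = (1 / m) * integral {0..m} q"
proof -
  let ?g = "\<lambda>u. indicator {0..m} u *\<^sub>R delta d (ray_law d r x f) u x powr r"
  have [measurable]: "q \<in> borel_measurable borel"
    using continuous_q by (rule borel_measurable_continuous_onI)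
  \<comment> \<open>At \<open>u = 0\<close> every radius qualifies and \<open>delta\<close> is 0,
    which may differ from the root of \<open>q 0\<close>. This one point is Lebesgue null, but it
    has to be split off again to get measurability of \<open>?g\<close>.\<close>
  have eq: "?g u = indicator {0..m} u *\<^sub>R q u" if "u \<noteq> 0" for u
  proof (cases "u \<in> {0..m}")
    case True
    then have "delta d (ray_law d r x f) u x = q u powr (1 / r)"
      using that assms by (intro delta_ray_law) auto
    then show ?thesis
      using assms q_nonneg[of u] by (simp add: powr_powr)
  qed simp
  then have "?g = (\<lambda>u. if u = 0 then ?g 0 else indicator {0..m} u *\<^sub>R q u)"
    by auto
  also have "\<dots> \<in> borel_measurable lborel"
    by measurable
  finally have meas: "?g \<in> borel_measurable lborel" .
  have "(LBINT u:{0..m}. delta d (ray_law d r x f) u x powr r) = (LBINT u:{0..m}. q u)"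
    unfolding set_lebesgue_integral_def
  proof (rule integral_cong_AE[OF meas])
    show "AE u in lborel. ?g u = indicator {0..m} u *\<^sub>R q u"
      using AE_lborel_singleton[of 0] by eventually_elim (rule eq)
  qed measurable
  also have "\<dots> = integral {0..m} q"
    by (rule set_borel_integral_eq_integral(2)[OF borel_integrable_atLeastAtMost'])
      (rule continuous_on_subset[OF continuous_q], simp)
  finally show ?thesis
    by (simp add: dtm_pow_def)
qed

text \<open>For positive arguments monotonicity of the modulus suffices. At 0 the class refers to a
  \<open>Lim\<close>, whose existence has to be shown: the oscillation is squeezed between 0 and a
  bound tending to \<open>\<omega> 0 = 0\<close>.\<close>

lemma ray_law_in_modulus_class:
  assumes "1 \<le> d" "1 \<le> r"
    and \<omega>: "continuous_on {0..1} \<omega>" "mono_on {0..1} \<omega>" "\<omega> 0 = 0"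
    and mod: "\<And>u v. u \<in> {0..1} \<Longrightarrow> v \<in> {0..1} \<Longrightarrow> \<bar>q u - q v\<bar> \<le> \<omega> \<bar>u - v\<bar>"
  shows "ray_law d r x f \<in> modulus_class d r x \<omega>"
proof -
  let ?F = "dist_cdf d r x (ray_law d r x f)"
  have upper: "quantile_osc ?F v \<le> ereal (\<omega> v)" if v: "0 < v" "v \<le> 1" for v
    unfolding quantile_osc_def
  proof (rule Sup_least, clarify)
    fix u u' :: real
    assume u: "u \<in> {0..1}" "u' \<in> {0..1}" "\<bar>u - u'\<bar> \<le> v"
    have "\<bar>q u - q u'\<bar> \<le> \<omega> \<bar>u - u'\<bar>"
      using mod u by blast
    also have "\<dots> \<le> \<omega> v"
      using u v by (intro mono_onD[OF \<omega>(2)]) auto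
    finally show "\<bar>quantile ?F u - quantile ?F u'\<bar> \<le> ereal (\<omega> v)"
      using u assms(1,2) by (simp add: quantile_ray_law)
  qed
  have "(\<omega> \<longlongrightarrow> 0) (at_right 0)"
    using \<omega>(1,3) unfolding continuous_on_def by (metis at_within_Icc_at_right atLeastAtMost_iff le_numeral_extra(3) zero_le_one zero_less_one)
  then have lim: "((\<lambda>v. ereal (\<omega> v)) \<longlongrightarrow> 0) (at_right 0)"
    by (simp add: zero_ereal_def)
  have "eventually (\<lambda>v. 0 < v \<and> v \<le> 1) (at_right (0::real))"
    by (auto simp: eventually_at_right_field intro!: exI[of _ 1])
  then have "eventually (\<lambda>v. 0 \<le> quantile_osc ?F v) (at_right 0)"
      "eventually (\<lambda>v. quantile_osc ?F v \<le> ereal (\<omega> v)) (at_right 0)"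
    by (eventually_elim, simp add: upper quantile_osc_nonneg)+
  from tendsto_sandwich[OF this tendsto_const lim]
  have "(quantile_osc ?F \<longlongrightarrow> 0) (at_right 0)" .
  then have "Lim (at_right 0) (quantile_osc ?F) = 0"
    by (rule tendsto_Lim[rotated]) simp
  then show ?thesis
    unfolding modulus_class_def quantile_modulus_def
    using upper \<omega>(3) prob_space_ray_law[OF measurable_f] by (auto simp: ray_law_def)
qed

end

section \<open>The competing law with shifted quantiles and Le Cam's comparison\<close>

text \<open>For \<open>t >= q 0\<close> let \<open>D\<close> be the part of
  \<open>{0..1 - a}\<close> where \<open>q <= t\<close>. Within the unit interval the two level sets
  are \<open>D\<close> with the top interval of length \<open>a\<close>, and the bottom interval of
  length \<open>a\<close> with \<open>D\<close> translated by \<open>a\<close>; their measures agree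
  by translation invariance. For \<open>t < q 0\<close> both level sets are empty.\<close>

lemma uniform_representation_shift:
  fixes q :: "real \<Rightarrow> real"
  assumes q: "continuous_on UNIV q" "mono q" "\<And>u. 0 \<le> q u" "\<And>u. u \<le> 0 \<Longrightarrow> q u = q 0"
    and a: "0 < a" "a \<le> 1"
  shows "uniform_representation (\<lambda>u. if u \<le> 1 - a then q u else q 0) (\<lambda>u. q (u - a))"
proof
  have [measurable]: "q \<in> borel_measurable borel"
    using q(1) by (rule borel_measurable_continuous_onI)
  show "(\<lambda>u. if u \<le> 1 - a then q u else q 0) \<in> borel_measurable borel"
    by measurable
  show "continuous_on UNIV (\<lambda>u. q (u - a))"
    by (rule continuous_on_compose2[OF q(1)]) (auto intro!: continuous_intros)
  show "mono (\<lambda>u. q (u - a))"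
    using q(2) by (auto simp: mono_def)
  have q0: "q 0 \<le> q u" for u
    using q(4)[of u] monoD[OF q(2), of 0 u] by (cases "u \<le> 0") auto
  show "measure unif {v. (if v \<le> 1 - a then q v else q 0) \<le> t} = measure unif {v. q (v - a) \<le> t}" for t
  proof (cases "q 0 \<le> t")
    case False
    then have "\<not> q u \<le> t" for u
      using q0[of u] by linarith
    then have "{v. (if v \<le> 1 - a then q v else q 0) \<le> t} = {}" "{v. q (v - a) \<le> t} = {}"
      by auto
    then show ?thesis by metis
  next
    case True
    define D where "D = {u \<in> {0..1 - a}. q u \<le> t}"
    have D [measurable]: "D \<in> sets borel"
      unfolding D_def by measurable
    have fD: "D \<in> fmeasurable lborel"
    proof (rule fmeasurableI2)
      show "cbox 0 (1 - a) \<in> fmeasurable lborel" by (rule fmeasurable_cbox)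
      show "D \<subseteq> cbox 0 (1 - a)" by (auto simp: D_def)
      show "D \<in> sets lborel" using D by simp
    qed
    have aD: "(+) a ` D = (\<lambda>u. u - a) -` D"
      by (force simp: image_iff)
    have "(\<lambda>u. u - a) -` D \<in> sets borel"
      using measurable_sets_borel[of "\<lambda>u. u - a" borel D] by simp
    then have aD_sets: "(+) a ` D \<in> sets borel"
      using aD by simp
    have aD_fm: "(+) a ` D \<in> fmeasurable lborel"
    proof (rule fmeasurableI2)
      show "cbox a 1 \<in> fmeasurable lborel" by (rule fmeasurable_cbox)
      show "(+) a ` D \<subseteq> cbox a 1" by (auto simp: D_def)
      show "(+) a ` D \<in> sets lborel" using aD_sets by simp
    qed
    have "{0..1} \<inter> {v. (if v \<le> 1 - a then q v else q 0) \<le> t} = D \<union> {1 - a<..1}"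
      using True a by (auto simp: D_def)
    moreover have "measure lborel (D \<union> {1 - a<..1}) = measure lborel D + a"
      using fD a by (subst measure_Union) (auto simp: D_def fmeasurable_def)
    moreover have "{0..1} \<inter> {v. q (v - a) \<le> t} = {0..<a} \<union> (+) a ` D"
    proof -
      have "q (v - a) \<le> t" if "v < a" for v
        using True q(4)[of "v - a"] that by simp
      then show ?thesis
        unfolding aD using a by (auto simp: D_def)
    qed
    moreover have "measure lborel ({0..<a} \<union> (+) a ` D) = a + measure lborel ((+) a ` D)"
      using aD_fm a by (subst measure_Union) (auto simp: D_def fmeasurable_def)
    moreover have "measure lborel ((+) a ` D) = measure lborel D"
      using measure_translation[of a D] aD_sets D by (simp add: measure_completion)
    ultimately show ?thesis
      by (subst (1 2) measure_unif) auto
  qed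
qed (use q(3) in auto)

text \<open>Le Cam's two-point bound: on the event that every coordinate falls in \<open>A\<close> both samples
  coincide, and there the two errors add up to at least \<open>\<bar>\<theta>0 - \<theta>1\<bar>\<close>.\<close>

lemma two_point_lower_bound:
  fixes S :: "('i \<Rightarrow> 'b) \<Rightarrow> real"
  assumes M: "prob_space M" and I: "finite I"
    and g [measurable]: "g0 \<in> measurable M E" "g1 \<in> measurable M E"
    and A: "A \<in> sets M" "\<And>w. w \<in> A \<Longrightarrow> g0 w = g1 w"
    and S [measurable]: "S \<in> borel_measurable (\<Pi>\<^sub>M i\<in>I. E)"
  shows "ennreal (\<bar>\<theta>0 - \<theta>1\<bar> * measure M A ^ card I) \<le>
    (\<integral>\<^sup>+ X. ennreal \<bar>S X - \<theta>0\<bar> \<partial>(\<Pi>\<^sub>M i\<in>I. distr M E g0)) +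
    (\<integral>\<^sup>+ X. ennreal \<bar>S X - \<theta>1\<bar> \<partial>(\<Pi>\<^sub>M i\<in>I. distr M E g1))"
proof -
  interpret M: prob_space M by fact
  interpret product_sigma_finite "\<lambda>_. M" ..
  let ?N = "\<Pi>\<^sub>M i\<in>I. M"
  have comp [measurable]: "compose I h \<in> measurable ?N (\<Pi>\<^sub>M i\<in>I. E)" if "h \<in> measurable M E" for h
    unfolding compose_def
    by (rule measurable_restrict) (rule measurable_compose[OF _ that], rule measurable_component_singleton)
  \<comment> \<open>Sampling from the law of \<open>h\<close> amounts to applying \<open>h\<close>
    to each coordinate of a sample from \<open>M\<close>. Both risks thus become integrals over the
    same product space \<open>?N\<close>, which realises the coupling.\<close>
  have push: "(\<integral>\<^sup>+ X. ennreal \<bar>S X - \<theta>\<bar> \<partial>(\<Pi>\<^sub>M i\<in>I. distr M E h)) =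
      (\<integral>\<^sup>+ w. ennreal \<bar>S (compose I h w) - \<theta>\<bar> \<partial>?N)" if [measurable]: "h \<in> measurable M E" for h \<theta>
  proof -
    let ?D = "distr M E h"
    have "distr ?N (\<Pi>\<^sub>M i\<in>I. ?D) (compose I h) = (\<Pi>\<^sub>M i\<in>I. distr M ?D h)"
      using I M M.prob_space_distr[OF that] by (intro distr_PiM_finite_prob_space') simp_all
    also have "distr M ?D h = ?D"
      by (intro distr_cong) simp_all
    also have "distr ?N (\<Pi>\<^sub>M i\<in>I. ?D) (compose I h) = distr ?N (\<Pi>\<^sub>M i\<in>I. E) (compose I h)"
      by (intro distr_cong sets_PiM_cong) simp_all
    finally have "(\<Pi>\<^sub>M i\<in>I. ?D) = distr ?N (\<Pi>\<^sub>M i\<in>I. E) (compose I h)" ..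
    then show ?thesis
      by (simp add: nn_integral_distr)
  qed
  have "ennreal (\<bar>\<theta>0 - \<theta>1\<bar> * measure M A ^ card I) = ennreal \<bar>\<theta>0 - \<theta>1\<bar> * emeasure ?N (\<Pi>\<^sub>E i\<in>I. A)"
    using I A(1) by (simp add: emeasure_PiM M.emeasure_eq_measure ennreal_mult ennreal_power)
  also have "\<dots> = (\<integral>\<^sup>+ w. ennreal \<bar>\<theta>0 - \<theta>1\<bar> * indicator (\<Pi>\<^sub>E i\<in>I. A) w \<partial>?N)"
    using I A(1) by (intro nn_integral_cmult_indicator[symmetric] sets_PiM_I_finite) auto
  also have "\<dots> \<le> (\<integral>\<^sup>+ w. ennreal \<bar>S (compose I g0 w) - \<theta>0\<bar> + ennreal \<bar>S (compose I g1 w) - \<theta>1\<bar> \<partial>?N)"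
  proof (rule nn_integral_mono)
    fix w
    show "ennreal \<bar>\<theta>0 - \<theta>1\<bar> * indicator (\<Pi>\<^sub>E i\<in>I. A) w \<le>
      ennreal \<bar>S (compose I g0 w) - \<theta>0\<bar> + ennreal \<bar>S (compose I g1 w) - \<theta>1\<bar>"
    proof (cases "w \<in> (\<Pi>\<^sub>E i\<in>I. A)")
      case True
      then have "compose I g0 w = compose I g1 w"
        using A(2) by (auto simp: compose_def PiE_iff)
      then show ?thesis
        using True by (simp flip: ennreal_plus)
    qed simp
  qed
  also have "\<dots> = (\<integral>\<^sup>+ w. ennreal \<bar>S (compose I g0 w) - \<theta>0\<bar> \<partial>?N) + (\<integral>\<^sup>+ w. ennreal \<bar>S (compose I g1 w) - \<theta>1\<bar> \<partial>?N)"
    by (rule nn_integral_add) measurable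
  finally show ?thesis
    by (simp add: push)
qed

section \<open>Quantile functions of nonnegative laws and of members of the class\<close>

context
  fixes M :: "real measure"
  assumes M: "real_distribution M" and nonneg: "\<And>t. t < 0 \<Longrightarrow> cdf M t = 0"
begin

interpretation real_distribution M by (rule M)

lemma quantile_ge_0:
  assumes "u \<in> {0..1}"
  shows "0 \<le> quantile (cdf M) u"
proof -
  have pos: "0 \<le> t" if "cdf M t > 0" for t
    using nonneg[of t] that by (cases "t < 0") auto
  consider "u = 0" | "u = 1" | "0 < u" "u < 1"
    using assms by fastforce
  then show ?thesis
  proof cases
    case 1
    then show ?thesis
      unfolding quantile_def using pos by (auto intro!: INF_greatest)
  next
    case 2
    have "0 \<le> Sup (ereal ` {t. cdf M t < 1})"
      unfolding le_Sup_iff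
    proof (intro allI impI)
      fix y :: ereal assume "y < 0"
      then obtain z where "y < ereal z" "ereal z < 0"
        using ereal_dense2 by blast
      then show "\<exists>a\<in>ereal ` {t. cdf M t < 1}. y < a"
        using nonneg[of z] by (auto intro!: exI[of _ z])
    qed
    with 2 show ?thesis by (simp add: quantile_def)
  next
    case 3
    then show ?thesis
      unfolding quantile_def using pos by (auto intro!: INF_greatest)
  qed
qed

text \<open>Different clauses of \<open>quantile\<close> meet here. For \<open>v < 1\<close> the
  sets under the infima are nested, also when \<open>u = 0\<close>. For \<open>v = 1\<close>, any
  real above the supremum has distribution function at least 1, hence belongs to the set whose
  infimum is the quantile at \<open>u\<close>.\<close>

lemma quantile_cdf_mono:
  assumes "0 \<le> u" "u \<le> v" "v \<le> 1"
  shows "quantile (cdf M) u \<le> quantile (cdf M) v"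
proof -
  consider "u = v" | "u < v" "v < 1" | "u < v" "v = 1"
    using assms by fastforce
  then show ?thesis
  proof cases
    case 2
    then show ?thesis
      unfolding quantile_def using assms by (auto intro!: INF_superset_mono)
  next
    case 3
    have "quantile (cdf M) u \<le> Sup (ereal ` {t. cdf M t < 1})"
    proof (rule dense_ge)
      fix y assume y: "Sup (ereal ` {t. cdf M t < 1}) < y"
      then obtain z where z: "Sup (ereal ` {t. cdf M t < 1}) < ereal z" "ereal z < y"
        using ereal_dense2 by blast
      then have "\<not> cdf M z < 1"
        using SUP_upper[of z "{t. cdf M t < 1}" ereal] by auto
      then have "quantile (cdf M) u \<le> ereal z"
        unfolding quantile_def using 3 by (auto intro!: INF_lower)
      with z(2) show "quantile (cdf M) u \<le> y" by simp
    qed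
    with 3 show ?thesis by (simp add: quantile_def)
  qed simp
qed

lemma quantile_cdf_finite:
  assumes "0 \<le> u" "u < 1"
  shows "quantile (cdf M) u < \<infinity>"
proof -
  have "eventually (\<lambda>t. u < cdf M t) at_top"
    using cdf_lim_at_top_prob assms(2) by (rule order_tendstoD)
  then obtain t where "u < cdf M t"
    by (auto simp: eventually_at_top_linorder)
  then have "quantile (cdf M) u \<le> ereal t"
    unfolding quantile_def using assms by (auto intro!: INF_lower)
  then show ?thesis
    by (rule order_le_less_trans) simp
qed

text \<open>The quantile at 0 is an infimum over points of positive distribution function. A point
  \<open>t\<close> close to it bounds the quantiles of all levels in \<open>(0, cdf M t]\<close>
  below 1.\<close>

lemma quantile_cdf_right_continuous_0:
  assumes "0 < e" "0 < v"
  obtains u where "0 < u" "u \<le> v" "quantile (cdf M) u \<le> quantile (cdf M) 0 + ereal e"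
proof -
  have "quantile (cdf M) 0 \<noteq> \<infinity>" "0 \<le> quantile (cdf M) 0"
    using quantile_cdf_finite[of 0] quantile_ge_0[of 0] by auto
  then have "quantile (cdf M) 0 < quantile (cdf M) 0 + ereal e"
    using assms(1) by (cases "quantile (cdf M) 0") auto
  then have "Inf (ereal ` {t. cdf M t > 0}) < quantile (cdf M) 0 + ereal e"
    by (simp add: quantile_def)
  then obtain t where t: "cdf M t > 0" "ereal t < quantile (cdf M) 0 + ereal e"
    by (auto simp: INF_less_iff)
  \<comment> \<open>The cap \<open>1 / 2\<close> keeps \<open>u\<close> away from 1, so that the
    interior clause of \<open>quantile\<close> applies.\<close>
  define u where "u = min (min v (cdf M t)) (1 / 2)"
  have u: "0 < u" "u \<le> v" "u < 1" "u \<le> cdf M t"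
    using t assms by (auto simp: u_def)
  then have "quantile (cdf M) u \<le> ereal t"
    unfolding quantile_def by (auto intro!: INF_lower)
  with t u show ?thesis
    by (intro that[of u]) auto
qed

end

lemma real_distribution_edist_powr:
  assumes "P \<in> modulus_class d r x \<omega>"
  shows "real_distribution (distr P borel (\<lambda>y. edist d x y powr r))"
    and "t < 0 \<Longrightarrow> cdf (distr P borel (\<lambda>y. edist d x y powr r)) t = 0"
proof -
  have [measurable_cong]: "sets P = sets (euclid d)" and P: "prob_space P"
    using assms by (auto simp: modulus_class_def)
  interpret prob_space P by fact
  have [measurable]: "(\<lambda>y. edist d x y powr r) \<in> borel_measurable P"
    by measurable
  show "real_distribution (distr P borel (\<lambda>y. edist d x y powr r))"
    by (rule real_distribution_distr) measurable
  assume "t < 0"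
  then have "(\<lambda>y. edist d x y powr r) -` {..t} = {}"
    by (auto dest: order_le_less_trans simp: not_less)
  then show "cdf (distr P borel (\<lambda>y. edist d x y powr r)) t = 0"
    unfolding cdf_def by (subst measure_distr) auto
qed

text \<open>Quantile functions are right continuous at 0, so the hypothesis \<open>lower\<close> makes \<open>\<omega>\<close>
  arbitrarily small near 0.\<close>

lemma modulus_zero:
  assumes P: "P \<in> modulus_class d r x \<omega>"
    and \<omega>: "continuous_on {0..1} \<omega>" "mono_on {0..1} \<omega>"
    and c: "0 < c" and ubar: "0 < ubar" "ubar < 1"
    and lower: "\<And>u. u \<in> {0<..ubar} \<Longrightarrow>
      ereal c * (quantile (dist_cdf d r x P) u - quantile (dist_cdf d r x P) 0) \<ge> ereal (\<omega> u)"
  shows "\<omega> 0 = 0"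
proof (rule antisym)
  let ?M = "distr P borel (\<lambda>y. edist d x y powr r)"
  let ?Q = "quantile (cdf ?M)"
  note M = real_distribution_edist_powr[OF P]
  have Q0: "?Q 0 \<noteq> \<infinity>" "0 \<le> ?Q 0"
    using quantile_cdf_finite[OF M, of 0] quantile_ge_0[OF M, of 0] by auto
  show "\<omega> 0 \<le> 0"
  proof (rule field_le_epsilon)
    fix e :: real assume "0 < e"
    with c obtain u where u: "0 < u" "u \<le> ubar" "?Q u \<le> ?Q 0 + ereal (e / c)"
      using quantile_cdf_right_continuous_0[OF M, of "e / c" ubar] ubar(1) by auto
    have "?Q u \<noteq> \<infinity>" "0 \<le> ?Q u"
      using quantile_cdf_finite[OF M, of u] quantile_ge_0[OF M, of u] u ubar by auto
    then obtain a b where ab: "?Q u = ereal a" "?Q 0 = ereal b"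
      using Q0 by (cases "?Q u"; cases "?Q 0") auto
    have "\<omega> 0 \<le> \<omega> u"
      using u ubar by (intro mono_onD[OF \<omega>(2)]) auto
    also have "\<omega> u \<le> c * (a - b)"
      using lower[of u] u ab by (simp add: dist_cdf_def)
    also have "c * (a - b) \<le> c * (e / c)"
      using u(3) ab c by (intro mult_left_mono) auto
    finally show "\<omega> 0 \<le> 0 + e"
      using c by simp
  qed
  \<comment> \<open>At 0 the class only bounds a \<open>Lim\<close>. Nonnegativity is therefore read
    off at positive arguments, from the oscillation, and passed to the limit by continuity.\<close>
  have "(\<omega> \<longlongrightarrow> \<omega> 0) (at 0 within {0..1})"
    using \<omega>(1) by (auto simp: continuous_on_def)
  then have "(\<omega> \<longlongrightarrow> \<omega> 0) (at_right 0)"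
    by (simp add: at_within_Icc_at_right)
  moreover have "eventually (\<lambda>v. 0 < v \<and> v \<le> 1) (at_right (0::real))"
    by (auto simp: eventually_at_right_field intro!: exI[of _ 1])
  then have "eventually (\<lambda>v. 0 \<le> \<omega> v) (at_right 0)"
  proof eventually_elim
    case (elim v)
    have "0 \<le> quantile_osc (cdf ?M) v"
      using elim by (intro quantile_osc_nonneg) simp
    also have "\<dots> \<le> ereal (\<omega> v)"
      using P elim by (auto simp: modulus_class_def quantile_modulus_def dist_cdf_def dest!: bspec[of _ _ v])
    finally show ?case by simp
  qed
  ultimately show "0 \<le> \<omega> 0"
    by (rule tendsto_lowerbound) simp
qed

text \<open>This replaces the extended-real quantile function by a finite continuous function on the
  whole line, which can be shifted while keeping its modulus.\<close>

lemma modulus_class_quantile: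
  assumes P: "P \<in> modulus_class d r x \<omega>"
    and \<omega>: "continuous_on {0..1} \<omega>" "mono_on {0..1} \<omega>" "\<omega> 0 = 0"
  obtains q :: "real \<Rightarrow> real" where "continuous_on UNIV q" "mono q" "\<And>u. 0 \<le> q u"
    "\<And>u. u \<le> 0 \<Longrightarrow> q u = q 0"
    "\<And>u. u \<in> {0..1} \<Longrightarrow> quantile (dist_cdf d r x P) u = ereal (q u)"
    "\<And>u v. \<bar>u - v\<bar> \<le> 1 \<Longrightarrow> \<bar>q u - q v\<bar> \<le> \<omega> \<bar>u - v\<bar>"
proof -
  let ?M = "distr P borel (\<lambda>y. edist d x y powr r)"
  let ?Q = "quantile (cdf ?M)"
  note M = real_distribution_edist_powr[OF P]
  have mod: "\<bar>?Q u - ?Q v\<bar> \<le> ereal (\<omega> \<bar>u - v\<bar>)" if "u \<in> {0..1}" "v \<in> {0..1}" "u \<noteq> v" for u v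
  proof -
    have "\<bar>?Q u - ?Q v\<bar> \<le> quantile_osc (cdf ?M) \<bar>u - v\<bar>"
      unfolding quantile_osc_def using that by (intro Sup_upper) fastforce
    also have "\<bar>u - v\<bar> \<in> {0..1}" "\<bar>u - v\<bar> \<noteq> 0"
      using that by auto
    then have "quantile_osc (cdf ?M) \<bar>u - v\<bar> \<le> ereal (\<omega> \<bar>u - v\<bar>)"
      using P by (auto simp: modulus_class_def quantile_modulus_def dist_cdf_def dest!: bspec[of _ _ "\<bar>u - v\<bar>"])
    finally show ?thesis .
  qed
  have Q0: "?Q 0 \<noteq> \<infinity>" "0 \<le> ?Q 0"
    using quantile_cdf_finite[OF M, of 0] quantile_ge_0[OF M, of 0] by auto
  \<comment> \<open>The quantile at 1 differs from the finite quantile at 0 by at most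
    \<open>\<omega> 1\<close>, so membership in the class excludes the value infinity.\<close>
  have Q1: "?Q 1 \<noteq> \<infinity>"
    using mod[of 1 0] Q0 by (cases "?Q 0") auto
  define Qr where "Qr u = real_of_ereal (?Q u)" for u
  have Qr: "?Q u = ereal (Qr u)" if "u \<in> {0..1}" for u
  proof -
    have "?Q u \<noteq> \<infinity>" "0 \<le> ?Q u"
      using quantile_cdf_mono[OF M, of u 1] quantile_ge_0[OF M, of u] that Q1 by auto
    then show ?thesis
      unfolding Qr_def by (cases "?Q u") auto
  qed
  \<comment> \<open>Clamping to the unit interval extends the quantile function by constants; being
    1-Lipschitz, it preserves the modulus bound.\<close>
  define cl :: "real \<Rightarrow> real" where "cl u = max 0 (min 1 u)" for u
  have cl: "cl u \<in> {0..1}" for u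
    by (auto simp: cl_def)
  define q where "q u = Qr (cl u)" for u
  have q_mod: "\<bar>q u - q v\<bar> \<le> \<omega> \<bar>cl u - cl v\<bar>" for u v
    using mod[OF cl cl, of u v] Qr[OF cl, of u] Qr[OF cl, of v] \<omega>(3)
    by (cases "cl u = cl v") (auto simp: q_def)
  have cl_lip: "\<bar>cl u - cl v\<bar> \<le> \<bar>u - v\<bar>" for u v
    by (auto simp: cl_def max_def min_def)
  have cl_le_1: "\<bar>cl u - cl v\<bar> \<le> 1" for u v
    using cl[of u] cl[of v] by auto
  show ?thesis
  proof
    show "continuous_on UNIV q"
      unfolding continuous_on_iff
    proof (intro ballI allI impI)
      fix u e :: real assume "0 < e"
      have "\<exists>s>0. \<forall>v\<in>{0..1}. dist v 0 < s \<longrightarrow> dist (\<omega> v) (\<omega> 0) < e"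
        using \<omega>(1) \<open>0 < e\<close> unfolding continuous_on_iff by (meson atLeastAtMost_iff order_refl zero_le_one)
      then obtain s where s: "s > 0" "\<And>v. v \<in> {0..1} \<Longrightarrow> dist v 0 < s \<Longrightarrow> dist (\<omega> v) (\<omega> 0) < e"
        by blast
      have "dist (q v) (q u) < e" if "dist v u < s" for v
      proof -
        have "dist (\<omega> \<bar>cl v - cl u\<bar>) (\<omega> 0) < e"
          using that cl_lip[of v u] cl_le_1[of v u] by (intro s(2)) (auto simp: dist_real_def)
        then show ?thesis
          using q_mod[of v u] \<omega>(3) by (simp add: dist_real_def)
      qed
      then show "\<exists>s>0. \<forall>v\<in>UNIV. dist v u < s \<longrightarrow> dist (q v) (q u) < e"
        using s(1) by blast
    qed
    show "mono q"
    proof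
      fix u v :: real assume "u \<le> v"
      then have "?Q (cl u) \<le> ?Q (cl v)"
        by (intro quantile_cdf_mono[OF M]) (auto simp: cl_def)
      then show "q u \<le> q v"
        using Qr[OF cl, of u] Qr[OF cl, of v] by (simp add: q_def)
    qed
    show "0 \<le> q u" for u
      using quantile_ge_0[OF M cl, of u] Qr[OF cl, of u] by (simp add: q_def)
    show "q u = q 0" if "u \<le> 0" for u
      using that by (simp add: q_def cl_def)
    show "quantile (dist_cdf d r x P) u = ereal (q u)" if "u \<in> {0..1}" for u
      using Qr[OF that] that by (simp add: q_def cl_def dist_cdf_def)
    show "\<bar>q u - q v\<bar> \<le> \<omega> \<bar>u - v\<bar>" if "\<bar>u - v\<bar> \<le> 1" for u v
    proof -
      have "\<omega> \<bar>cl u - cl v\<bar> \<le> \<omega> \<bar>u - v\<bar>"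
        using that cl_lip[of u v] cl_le_1[of u v] by (intro mono_onD[OF \<omega>(2)]) auto
      then show ?thesis
        using q_mod[of u v] by linarith
    qed
  qed
qed

section \<open>The gap between the two distances and the minimax bound\<close>

text \<open>The shift replaces the window \<open>{0..m}\<close> by \<open>{- a..m - a}\<close>. The
  common part \<open>{0..m - a}\<close> cancels, leaving a top piece of length \<open>a\<close>
  where \<open>q >= q v\<close> against a bottom piece of length \<open>a\<close> where
  \<open>q\<close> equals \<open>q 0\<close>.\<close>

lemma integral_shift_diff_ge:
  fixes q :: "real \<Rightarrow> real"
  assumes q: "continuous_on UNIV q" "mono q" "\<And>u. u \<le> 0 \<Longrightarrow> q u = q 0"
    and a: "0 \<le> a" "a \<le> m" and v: "v \<le> m - a"
  shows "a * (q v - q 0) \<le> integral {0..m} q - integral {0..m} (\<lambda>u. q (u - a))"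
proof -
  have int: "q integrable_on {s..t}" for s t
    by (rule integrable_continuous_real) (rule continuous_on_subset[OF q(1)], simp)
  have "integral {0..m} (\<lambda>u. q (u - a)) = integral {- a..m - a} q"
    using integral_shift_real_ivl[of "- a" "- a" "m - a" q] by simp
  also have "\<dots> = integral {- a..0} q + integral {0..m - a} q"
    using a int by (intro Henstock_Kurzweil_Integration.integral_combine[symmetric]) auto
  also have "integral {- a..0} q = integral {- a..0} (\<lambda>_. q 0)"
    by (intro integral_cong q(3)) auto
  also have "\<dots> = a * q 0"
    using a by simp
  finally have 1: "integral {0..m} (\<lambda>u. q (u - a)) = a * q 0 + integral {0..m - a} q" .
  have 2: "integral {0..m} q = integral {0..m - a} q + integral {m - a..m} q"
    using a int by (intro Henstock_Kurzweil_Integration.integral_combine[symmetric]) auto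
  have "integral {m - a..m} (\<lambda>_. q v) \<le> integral {m - a..m} q"
    using v int by (intro integral_le monoD[OF q(2)]) auto
  then have "a * q v \<le> integral {m - a..m} q"
    using a by simp
  with 1 2 show ?thesis
    by (simp add: algebra_simps)
qed

lemma ennreal_le_of_double:
  assumes "ennreal (2 * x) \<le> s + s" shows "ennreal x \<le> s"
proof -
  have "ennreal (2 * x) = 2 * ennreal x"
    by (subst ennreal_mult') simp_all
  moreover have "s + s = 2 * s"
    by (rule mult_2[symmetric])
  ultimately have "2 * ennreal x \<le> 2 * s" using assms by metis
  then show ?thesis by (subst (asm) ennreal_mult_le_mult_iff) simp_all
qed

lemma minimax_lower_bound:
  fixes n k :: nat
  assumes c: "0 < c" and d: "1 \<le> d" and r: "1 \<le> r"
    and \<omega>: "continuous_on {0..1} \<omega>" "mono_on {0..1} \<omega>"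
    and ubar: "0 < ubar" "ubar < 1"
    and P: "P \<in> modulus_class d r x \<omega>"
    and lower: "\<And>u. u \<in> {0<..ubar} \<Longrightarrow>
      ereal c * (quantile (dist_cdf d r x P) u - quantile (dist_cdf d r x P) 0) \<ge> ereal (\<omega> u)"
    and n: "1 \<le> n" and k: "1 \<le> k" "real k \<le> ubar * real n"
    and T: "T \<in> estimators d n"
  shows "ennreal (1 / (8 * c) * (real n / real k) * (1 / real n) * \<omega> ((real k - 1) / real n)) \<le>
    (SUP P\<in>modulus_class d r x \<omega>.
          \<integral>\<^sup>+ X. ennreal \<bar>T X powr r - dtm_pow d P (real k / real n) r x\<bar> \<partial>sample_law n P)"
    (is "_ \<le> ?sup")
proof -
  have \<omega>0: "\<omega> 0 = 0"
    by (rule modulus_zero[OF P \<omega> c ubar lower])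
  obtain q where q: "continuous_on UNIV q" "mono q" "\<And>u. 0 \<le> q u" "\<And>u. u \<le> 0 \<Longrightarrow> q u = q 0"
    and quantile_q: "\<And>u. u \<in> {0..1} \<Longrightarrow> quantile (dist_cdf d r x P) u = ereal (q u)"
    and q_mod: "\<And>u v. \<bar>u - v\<bar> \<le> 1 \<Longrightarrow> \<bar>q u - q v\<bar> \<le> \<omega> \<bar>u - v\<bar>"
    using modulus_class_quantile[OF P \<omega> \<omega>0] by blast
  \<comment> \<open>Half of the mass \<open>1 / n\<close> of a sample point, so that Bernoulli's inequality keeps the
    probability \<open>(1 - a) ^ n\<close> of identical samples above \<open>1 / 2\<close>.\<close>
  define a where "a = 1 / (2 * real n)"
  define m where "m = real k / real n"
  define v where "v = (real k - 1) / real n"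
  \<comment> \<open>The point \<open>v\<close> lies a full \<open>1 / n\<close> below
    \<open>m\<close>, and \<open>a\<close> is only half of that, whence
    \<open>v <= m - a\<close>.\<close>
  have a: "0 < a" "a \<le> 1" "a \<le> m" "v \<le> m - a"
    using n k by (auto simp: a_def m_def v_def field_simps)
  have "m \<le> ubar"
    using k n by (simp add: m_def field_simps)
  then have m: "0 < m" "m \<le> 1"
    using ubar(2) a(1,3) by linarith+
  have v: "0 \<le> v" "v \<le> ubar"
    using k(1) a \<open>m \<le> ubar\<close> by (simp add: v_def, linarith)
  define f where "f = (\<lambda>u. if u \<le> 1 - a then q u else q 0)"
  interpret q: uniform_representation q q
    by standard (use q(1-3) in \<open>auto intro: borel_measurable_continuous_onI\<close>)
  interpret f: uniform_representation f "\<lambda>u. q (u - a)"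
    unfolding f_def using uniform_representation_shift[OF q a(1,2)] .
  let ?P0 = "ray_law d r x q" and ?P1 = "ray_law d r x f"
  have P0: "?P0 \<in> modulus_class d r x \<omega>"
    by (rule q.ray_law_in_modulus_class[OF d r \<omega> \<omega>0]) (auto intro!: q_mod)
  \<comment> \<open>The shifted arguments may be negative, but their difference is unchanged and at
    most 1, which is all that \<open>q_mod\<close> asks for.\<close>
  have P1: "?P1 \<in> modulus_class d r x \<omega>"
  proof (rule f.ray_law_in_modulus_class[OF d r \<omega> \<omega>0])
    show "\<bar>q (u - a) - q (v - a)\<bar> \<le> \<omega> \<bar>u - v\<bar>" if "u \<in> {0..1}" "v \<in> {0..1}" for u v
      using q_mod[of "u - a" "v - a"] that by auto
  qed
  let ?th0 = "dtm_pow d ?P0 m r x" and ?th1 = "dtm_pow d ?P1 m r x"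
  have "\<omega> v \<le> c * (q v - q 0)"
  \<comment> \<open>For \<open>k = 1\<close> the point \<open>v\<close> is 0, outside the range of
    \<open>lower\<close>; both sides then vanish because \<open>\<omega> 0 = 0\<close>.\<close>
  proof (cases "v = 0")
    case False
    then show ?thesis
      using lower[of v] v ubar quantile_q[of v] quantile_q[of 0] by simp
  qed (simp add: \<omega>0)
  then have "a * (\<omega> v / c) \<le> a * (q v - q 0)"
    using a c by (intro mult_left_mono) (auto simp: field_simps)
  also have "\<dots> \<le> integral {0..m} q - integral {0..m} (\<lambda>u. q (u - a))"
    by (rule integral_shift_diff_ge[OF q(1,2,4)]) (use a in auto)
  also have "\<dots> = m * (?th0 - ?th1)"
    using m q.dtm_pow_ray_law[OF d r m, of x] f.dtm_pow_ray_law[OF d r m, of x] by (simp add: field_simps)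
  finally have "a * (\<omega> v / c) / m \<le> ?th0 - ?th1"
    unfolding pos_divide_le_eq[OF m(1)] by (simp only: mult.commute)
  then have gap: "a * (\<omega> v / c) / m \<le> \<bar>?th0 - ?th1\<bar>"
    by linarith
  have bernoulli: "1 / 2 \<le> (1 - a) ^ n"
    using Bernoulli_inequality[of "- a" n] a n by (simp add: a_def field_simps)
  define S where "S = (\<lambda>X. T X powr r)"
  have S: "S \<in> borel_measurable (\<Pi>\<^sub>M i\<in>{1..n}. euclid d)"
    using T by (auto simp: estimators_def S_def)
  have "a * (\<omega> v / c) / m / 2 \<le> \<bar>?th0 - ?th1\<bar> * (1 - a) ^ n"
    using mult_mono[OF gap bernoulli] by simp
  then have "ennreal (a * (\<omega> v / c) / m / 2) \<le> ennreal (\<bar>?th0 - ?th1\<bar> * measure unif {..1 - a} ^ card {1..n})"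
    using a by (intro ennreal_leI) (simp add: measure_unif_atMost)
  also have "\<dots> \<le> (\<integral>\<^sup>+ X. ennreal \<bar>S X - ?th0\<bar> \<partial>sample_law n ?P0) + (\<integral>\<^sup>+ X. ennreal \<bar>S X - ?th1\<bar> \<partial>sample_law n ?P1)"
    unfolding sample_law_def ray_law_def
    by (rule two_point_lower_bound[OF prob_space_unif _ _ _ _ _ S]) (auto simp: f_def)
  also have "\<dots> \<le> ?sup + ?sup"
    unfolding S_def m_def by (intro add_mono SUP_upper P0 P1)
  finally have "ennreal (a * (\<omega> v / c) / m / 2) \<le> ?sup + ?sup" .
  \<comment> \<open>Since \<open>a / m = 1 / (2 * k)\<close>, the constant
    \<open>1 / (8 * c)\<close> collects three factors \<open>1 / 2\<close>: from \<open>a\<close>,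
    from Bernoulli's inequality, and from bounding the sum of two risks by twice the
    supremum.\<close>
  moreover have "a * (\<omega> v / c) / m / 2 = 2 * (1 / (8 * c) * (real n / real k) * (1 / real n) * \<omega> v)"
    using n k c by (simp add: a_def m_def field_simps)
  ultimately have "ennreal (2 * (1 / (8 * c) * (real n / real k) * (1 / real n) * \<omega> v)) \<le> ?sup + ?sup"
    by (simp only:)
  then show ?thesis
    unfolding v_def by (rule ennreal_le_of_double)
qed

theorem proposition1:
  fixes c :: real
  assumes "c > 0"
  shows "\<exists>C>0. \<forall>(d::nat) (r::real) (x::nat \<Rightarrow> real) (\<omega>::real \<Rightarrow> real) (ubar::real).
    1 \<le> d \<longrightarrow> 1 \<le> r \<longrightarrow> x \<in> space (euclid d) \<longrightarrow>
    continuous_on {0..1} \<omega> \<longrightarrow> mono_on {0..1} \<omega> \<longrightarrow>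
    0 < ubar \<longrightarrow> ubar < 1 \<longrightarrow>
    (\<exists>P\<in>modulus_class d r x \<omega>. \<forall>u\<in>{0<..ubar}.
       ereal c * (quantile (dist_cdf d r x P) u - quantile (dist_cdf d r x P) 0) \<ge> ereal (\<omega> u)) \<longrightarrow>
    (\<forall>(n::nat) (k::nat). 1 \<le> n \<longrightarrow> 1 \<le> k \<longrightarrow> real k \<le> ubar * real n \<longrightarrow>
       (SUP P\<in>modulus_class d r x \<omega>.
          \<integral>\<^sup>+ X. ennreal \<bar>Delta d P n (real k / real n) r x X\<bar> \<partial>sample_law n P)
       \<ge> (INF T\<in>estimators d n. SUP P\<in>modulus_class d r x \<omega>.
          \<integral>\<^sup>+ X. ennreal \<bar>T X powr r - dtm_pow d P (real k / real n) r x\<bar> \<partial>sample_law n P)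
       \<and>
       (INF T\<in>estimators d n. SUP P\<in>modulus_class d r x \<omega>.
          \<integral>\<^sup>+ X. ennreal \<bar>T X powr r - dtm_pow d P (real k / real n) r x\<bar> \<partial>sample_law n P)
       \<ge> ennreal (C * (real n / real k) * (1 / real n) * \<omega> ((real k - 1) / real n)))"
proof (intro exI[of _ "1 / (8 * c)"] conjI allI impI)
  show "1 / (8 * c) > 0"
    using assms by simp
next
  fix d n k :: nat and r ubar :: real and x :: "nat \<Rightarrow> real" and \<omega> :: "real \<Rightarrow> real"
  assume d: "1 \<le> d" and r: "1 \<le> r"
    and \<omega>: "continuous_on {0..1} \<omega>" "mono_on {0..1} \<omega>"
    and ubar: "0 < ubar" "ubar < 1"
    and n: "1 \<le> n" and k: "1 \<le> k" "real k \<le> ubar * real n"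
  have "ubar * real n \<le> 1 * real n"
    using ubar by (intro mult_right_mono) simp_all
  with k(2) have "real k \<le> real n"
    by linarith
  then have m: "0 \<le> real k / real n" "real k / real n \<le> 1"
    using k n by simp_all
  show "(INF T\<in>estimators d n. SUP P\<in>modulus_class d r x \<omega>.
          \<integral>\<^sup>+ X. ennreal \<bar>T X powr r - dtm_pow d P (real k / real n) r x\<bar> \<partial>sample_law n P)
      \<le> (SUP P\<in>modulus_class d r x \<omega>.
          \<integral>\<^sup>+ X. ennreal \<bar>Delta d P n (real k / real n) r x X\<bar> \<partial>sample_law n P)"
    by (rule minimax_le_empirical_risk[OF n r m])
  assume "\<exists>P\<in>modulus_class d r x \<omega>. \<forall>u\<in>{0<..ubar}.
       ereal c * (quantile (dist_cdf d r x P) u - quantile (dist_cdf d r x P) 0) \<ge> ereal (\<omega> u)"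
  then obtain P where P: "P \<in> modulus_class d r x \<omega>"
    and lower: "\<And>u. u \<in> {0<..ubar} \<Longrightarrow>
      ereal c * (quantile (dist_cdf d r x P) u - quantile (dist_cdf d r x P) 0) \<ge> ereal (\<omega> u)"
    by blast
  show "ennreal (1 / (8 * c) * (real n / real k) * (1 / real n) * \<omega> ((real k - 1) / real n)) \<le>
      (INF T\<in>estimators d n. SUP P\<in>modulus_class d r x \<omega>.
          \<integral>\<^sup>+ X. ennreal \<bar>T X powr r - dtm_pow d P (real k / real n) r x\<bar> \<partial>sample_law n P)"
    by (rule INF_greatest) (rule minimax_lower_bound[OF assms d r \<omega> ubar P lower n k])
qed

end
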